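(* Let $G$ be an abelian group and $\mathcal A=(A_1,\dots,A_q)$ where for each $i$, $A_i=F_i+M_i$ with $F_i\subseteq G$ finite and nonempty, $M_i\subseteq G$ a submonoid (i.e. $0\in M_i$, $M_i+M_i\subseteq M_i$), and $k_i:=|F_i|$. Then for every $r\in\mathbb N$ and every $\mathbf h\in\mathbb N_0^q$ there exists $X_{\mathbf h}\subseteq G$ with $(r\mathbf h)\cdot\mathcal A\subseteq X_{\mathbf h}+\mathbf h\cdot\mathcal A$ and \[ |X_{\mathbf h}|\le\prod_{i=1}^q\binom{(r+1)(k_i-1)}{k_i-1}. \] In particular $\mathcal A$ is a chromatic $(r,\ell)$-approximate group with $\ell=\prod_{i=1}^q\binom{(r+1)(k_i-1)}{k_i-1}$.
   Context: $\mathbb N=\{1,2,\dots\}$, $\mathbb N_0=\{0,1,2,\dots\}$. For subsets $X,Y$ of an abelian group, $X+Y=\{x+y:x\in X,y\in Y\}$; for $h\in\mathbb N$, $hA$ is the $h$-fold sumset $A+\cdots+A$ and $0A=\{0\}$. For $\mathbf h=(h_1,\dots,h_q)\in\mathbb N_0^q$, $\mathbf h\cdot\mathcal A=h_1A_1+\cdots+h_qA_q$ and $r\mathbf h=(rh_1,\dots,rh_q)$. A tuple $\mathcal A$ is a chromatic $(r,\ell)$-approximate group if for every $\mathbf h\in\mathbb N_0^q$ there is $X_{\mathbf h}\subseteq G$ with $|X_{\mathbf h}|\le\ell$ and $(r\mathbf h)\cdot\mathcal A\subseteq X_{\mathbf h}+\mathbf h\cdot\mathcal A$. *)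

theory Defs
  imports Complex_Main "HOL-Library.Set_Algebras"
begin

text \<open>
  Addition of sets is the Minkowski sum of \<^theory>\<open>HOL-Library.Set_Algebras\<close>, whose zero
  is \<open>{0}\<close>. Sums \<open>\<Sum>\<close> of sets below are sums in this commutative monoid; in particular
  \<open>sumset 0 A = {0}\<close>, and \<open>sumset n A\<close> is in general different from \<open>{n * a | a. a \<in> A}\<close>.
\<close>

definition sumset :: "nat \<Rightarrow> 'a::ab_group_add set \<Rightarrow> 'a set" where
  "sumset n A = (\<Sum>j\<in>{1..n}. A)"

text \<open>
  A \<open>q\<close>-tuple is represented by a function on \<^typ>\<open>nat\<close> of which only the values at
  \<open>1, \<dots>, q\<close> matter.
\<close>

definition chromatic_sumset ::
    "nat \<Rightarrow> (nat \<Rightarrow> nat) \<Rightarrow> (nat \<Rightarrow> 'a::ab_group_add set) \<Rightarrow> 'a set" where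
  "chromatic_sumset q h A = (\<Sum>i\<in>{1..q}. sumset (h i) (A i))"

definition chromatic_approximate_group ::
    "nat \<Rightarrow> nat \<Rightarrow> nat \<Rightarrow> (nat \<Rightarrow> 'a::ab_group_add set) \<Rightarrow> bool" where
  "chromatic_approximate_group r l q A \<longleftrightarrow>
     (\<forall>h. \<exists>X. finite X \<and> card X \<le> l \<and>
        chromatic_sumset q (\<lambda>i. r * h i) A \<subseteq> X + chromatic_sumset q h A)"

definition is_submonoid :: "'a::ab_group_add set \<Rightarrow> bool" where
  "is_submonoid M \<longleftrightarrow> 0 \<in> M \<and> M + M \<subseteq> M"

end

theory Submission
  imports Defs "HOL-Library.Multiset"
begin

text \<open>
  An element of the \<open>(r * h)\<close>-fold sumset of \<open>F\<close>, with \<open>card F = n + 1\<close> and \<open>a \<in> F\<close>, is the sum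
  of a multiset on \<open>F\<close>. Divide the multiplicity of every element other than \<open>a\<close> by
  \<open>m = h div n + 1\<close>, the least number exceeding \<open>h / n\<close>. The remainders add up to at most
  \<open>n * (m - 1) \<le> h\<close>, so padded with copies of \<open>a\<close> they form an element of the \<open>h\<close>-fold sumset.
  The quotients add up to at most \<open>r * h / m \<le> r * n\<close>, so padded with copies of \<open>a\<close> they form a
  multiset of size \<open>r * n\<close> on \<open>F\<close>, of which there are \<open>((r + 1) * n) choose n\<close>. The copies of \<open>a\<close>
  used for padding amount to a fixed translation. Submonoids cause no loss, since
  the \<open>(r * h)\<close>-fold sumset of \<open>M\<close> is contained in its \<open>h\<close>-fold sumset.
\<close>

section \<open>Minkowski sums of finite families: inclusion and cardinality\<close>

lemma sum_set_mono:
  fixes S T :: "'i \<Rightarrow> 'a::comm_monoid_add set"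
  assumes "\<And>i. i \<in> I \<Longrightarrow> S i \<subseteq> T i"
  shows "sum S I \<subseteq> sum T I"
  using assms
proof (induction I rule: infinite_finite_induct)
  case (insert x I)
  then have "S x + sum S I \<subseteq> T x + sum T I" by (intro set_plus_mono2) auto
  with insert show ?case by simp
qed auto

lemma finite_sum_set:
  fixes S :: "'i \<Rightarrow> 'a::comm_monoid_add set"
  assumes "\<And>i. i \<in> I \<Longrightarrow> finite (S i)"
  shows "finite (sum S I)"
  using assms by (induction I rule: infinite_finite_induct) (auto intro!: finite_set_plus)

lemma card_set_plus_le:
  assumes "finite S" "finite T"
  shows "card (S + T) \<le> card S * card T"
  unfolding set_plus_image using assms
  by (metis card_cartesian_product card_image_le finite_cartesian_product)

lemma card_sum_set_le:
  fixes S :: "'i \<Rightarrow> 'a::comm_monoid_add set"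
  assumes "\<And>i. i \<in> I \<Longrightarrow> finite (S i)"
  shows "card (sum S I) \<le> (\<Prod>i\<in>I. card (S i))"
  using assms
proof (induction I rule: infinite_finite_induct)
  case (insert x I)
  then have "card (S x + sum S I) \<le> card (S x) * card (sum S I)"
    by (intro card_set_plus_le finite_sum_set) auto
  also have "\<dots> \<le> card (S x) * (\<Prod>i\<in>I. card (S i))"
    using insert by (intro mult_left_mono) auto
  finally show ?case using insert by simp
qed auto

section \<open>Iterated sumsets, multisets of summands, submonoids\<close>

lemma sumset_0 [simp]: "sumset 0 A = {0}"
  by (simp add: sumset_def)

lemma sumset_Suc: "sumset (Suc n) A = A + sumset n A"
  by (simp add: sumset_def add.commute)

lemma sumset_set_plus: "sumset n (A + B) = sumset n A + sumset n B"
  by (simp add: sumset_def sum.distrib)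

text \<open>Commutativity makes the order of the summands irrelevant. Passing to multisets exposes
  the multiplicities, which are divided later.\<close>

lemma sumset_eq_sum_mset:
  "sumset n A = sum_mset ` {Y. set_mset Y \<subseteq> A \<and> size Y = n}"
proof (induction n)
  case 0
  have "{Y. set_mset Y \<subseteq> A \<and> size Y = 0} = {{#}}" by auto
  then show ?case by simp
next
  case (Suc n)
  have "x + sum_mset Y \<in> sum_mset ` {Y. set_mset Y \<subseteq> A \<and> size Y = Suc n}"
    if "x \<in> A" "set_mset Y \<subseteq> A" "size Y = n" for x Y
    using that by (intro image_eqI[of _ _ "add_mset x Y"]) auto
  moreover have "sum_mset Y \<in> A + sum_mset ` {Y. set_mset Y \<subseteq> A \<and> size Y = n}"
    if "set_mset Y \<subseteq> A" "size Y = Suc n" for Y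
  proof -
    from \<open>size Y = Suc n\<close> obtain x Z where "Y = add_mset x Z"
      by (auto dest: size_eq_Suc_imp_eq_union)
    with that show ?thesis by auto
  qed
  ultimately show ?case
    by (auto simp: sumset_Suc Suc.IH elim!: set_plus_elim)
qed

lemma sumset_submonoid_subset:
  assumes "is_submonoid M"
  shows "sumset n M \<subseteq> M"
proof (induction n)
  case (Suc n)
  then have "M + sumset n M \<subseteq> M + M" by (intro set_plus_mono2) auto
  with assms show ?case by (auto simp: sumset_Suc is_submonoid_def)
qed (use assms in \<open>auto simp: is_submonoid_def\<close>)

lemma zero_in_sumset: "0 \<in> A \<Longrightarrow> 0 \<in> sumset n A"
  by (induction n) (auto simp: sumset_Suc dest: set_zero_plus2)

text \<open>By closure the left side lies in \<open>M\<close>. If \<open>h > 0\<close>, one summand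
  carries the element of \<open>M\<close> and the others are 0; if \<open>h = 0\<close>, both sides
  are \<open>{0}\<close>.\<close>

lemma sumset_mult_submonoid_subset:
  assumes "is_submonoid M"
  shows "sumset (r * h) M \<subseteq> sumset h M"
proof (cases h)
  case (Suc n)
  have "sumset (r * h) M \<subseteq> M" using assms by (rule sumset_submonoid_subset)
  also have "M \<subseteq> sumset n M + M"
    using assms by (intro set_zero_plus2 zero_in_sumset) (simp add: is_submonoid_def)
  finally show ?thesis by (simp add: Suc sumset_Suc add.commute)
qed auto

section \<open>Counting multisets of fixed size\<close>

lemma
  assumes "finite F" "F \<noteq> {}"
  shows finite_msets_of_size: "finite {Y. set_mset Y \<subseteq> F \<and> size Y = N}" (is "finite ?Y")
    and card_msets_of_size_le:
      "card {Y. set_mset Y \<subseteq> F \<and> size Y = N} \<le> (N + card F - 1) choose N"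
proof -
  obtain xs where xs: "set xs = F" "distinct xs"
    using finite_distinct_list[OF assms(1)] by blast
  \<comment> \<open>A multiset on \<open>F\<close> is encoded by its list of multiplicities along
    \<open>xs\<close>; stars and bars counts such lists.\<close>
  define L where "L = {l :: nat list. size l = card F \<and> sum_list l = N}"
  have card_L: "card L = (N + card F - 1) choose N"
    unfolding L_def using assms by (intro card_length_sum_list)
  \<comment> \<open>An infinite set has \<open>card\<close> 0, so positivity of the binomial
    coefficient already gives finiteness of \<open>L\<close>.\<close>
  have "card F > 0" using assms by (simp add: card_gt_0_iff)
  then have "card L > 0" unfolding card_L by (simp add: zero_less_binomial_iff)
  then have "finite L" by (rule card_ge_0_finite)
  have inj: "inj_on (\<lambda>Y. map (count Y) xs) ?Y"
  proof (rule inj_onI, rule multiset_eqI)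
    fix Y Z x assume *: "Y \<in> ?Y" "Z \<in> ?Y" "map (count Y) xs = map (count Z) xs"
    show "count Y x = count Z x"
    proof (cases "x \<in> F")
      case False
      with * have "x \<notin># Y" "x \<notin># Z" by auto
      then show ?thesis by (simp add: not_in_iff)
    qed (use * xs in auto)
  qed
  have "size Y = sum_list (map (count Y) xs)" if "set_mset Y \<subseteq> F" for Y
    using that assms(1) xs
    by (auto simp: size_multiset_overloaded_eq sum_list_distinct_conv_sum_set not_in_iff
        intro!: sum.mono_neutral_left)
  then have sub: "(\<lambda>Y. map (count Y) xs) ` ?Y \<subseteq> L"
    using xs by (auto simp: L_def distinct_card)
  show "finite ?Y" using inj_on_finite[OF inj sub \<open>finite L\<close>] .
  show "card ?Y \<le> (N + card F - 1) choose N"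
    using card_inj_on_le[OF inj sub \<open>finite L\<close>] card_L by simp
qed

section \<open>Division of multisets with remainder\<close>

lemma mset_div_mod:
  fixes Y :: "'a multiset"
  assumes "m > 0"
  obtains D R where "Y = repeat_mset m D + R" "\<And>x. count R x < m"
proof
  \<comment> \<open>The sum runs over the support of \<open>Y\<close>; outside it the quotient is 0
    as well, so \<open>count_D\<close> holds for every \<open>x\<close>.\<close>
  define D where "D = (\<Sum>x\<in>set_mset Y. replicate_mset (count Y x div m) x)"
  have count_D: "count D x = count Y x div m" for x
    by (cases "x \<in># Y") (auto simp: D_def count_sum sum.delta' not_in_iff)
  have sub: "repeat_mset m D \<subseteq># Y"
    by (auto simp: subseteq_mset_def count_D)
  show "Y = repeat_mset m D + (Y - repeat_mset m D)"
    using sub by simp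
  show "count (Y - repeat_mset m D) x < m" for x
    using assms by (simp add: count_D minus_mult_div_eq_mod)
qed

text \<open>Padding by \<open>a\<close> stands on both sides because subtraction of multisets is
  truncated. In the group, the two paddings merge into one translation.\<close>

lemma mset_split:
  fixes Y :: "'a multiset"
  assumes "finite F" "a \<in> F" "card F = Suc n" "set_mset Y \<subseteq> F" "size Y = r * h" "r \<ge> 1"
    and m: "m = h div n + 1"
  obtains Z W where "set_mset Z \<subseteq> F" "size Z = r * n" "set_mset W \<subseteq> F" "size W = h"
    "Y + replicate_mset (m * (r * n)) a = repeat_mset m Z + W + replicate_mset ((r - 1) * h) a"
proof -
  define c where "c = count Y a"
  define Y' where "Y' = filter_mset (\<lambda>x. x \<noteq> a) Y"
  have Y: "Y = Y' + replicate_mset c a"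
    by (auto simp: multiset_eq_iff Y'_def c_def)
  have "m > 0" using m by simp
  then obtain D R where DR: "Y' = repeat_mset m D + R" "\<And>x. count R x < m"
    using mset_div_mod[of m Y'] by blast
  have set_Y': "set_mset Y' \<subseteq> F - {a}" using assms by (auto simp: Y'_def)
  have set_R: "set_mset R \<subseteq> F - {a}" using set_Y' DR by auto
  have set_D: "set_mset D \<subseteq> F - {a}"
  proof -
    have "set_mset D \<subseteq> set_mset Y'"
      using DR(1) \<open>m > 0\<close> by (auto simp flip: count_greater_zero_iff)
    with set_Y' show ?thesis by blast
  qed
  \<comment> \<open>Every remainder is at most \<open>m - 1 = h div n\<close>, and
    \<open>F - {a}\<close> has \<open>n\<close> elements; comparing sizes bounds
    \<open>R\<close>.\<close>
  have "R \<subseteq># repeat_mset (h div n) (mset_set (F - {a}))"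
  proof (rule mset_subset_eqI)
    fix x
    show "count R x \<le> count (repeat_mset (h div n) (mset_set (F - {a}))) x"
    proof (cases "x \<in># R")
      case True
      with set_R have "x \<in> F - {a}" by blast
      with DR(2)[of x] m \<open>finite F\<close> show ?thesis by simp
    qed (simp add: not_in_iff)
  qed
  from size_mset_mono[OF this] have "size R \<le> h div n * n"
    using assms by simp
  also have "\<dots> \<le> h" by (rule div_times_less_eq_dividend)
  finally have size_R: "size R \<le> h" .
  have size_D: "size D \<le> r * n"
  \<comment> \<open>For \<open>n = 0\<close>, division by zero gives \<open>m = 1\<close> and
    \<open>h \<le> m * n\<close> may fail, but then \<open>F = {a}\<close> and \<open>D\<close> is
    empty.\<close>
  proof (cases "n = 0")
    case True
    with assms have "F - {a} = {}"
      by (metis One_nat_def card_1_singletonE Diff_cancel singletonD)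
    with set_D show ?thesis by simp
  next
    case False
    then have "h \<le> m * n"
      using m dividend_less_times_div[of n h] by (simp add: mult.commute)
    have "m * size D \<le> r * h"
      using assms(5) Y DR(1) by simp
    also have "\<dots> \<le> m * (r * n)" using \<open>h \<le> m * n\<close> by (simp add: mult.left_commute)
    finally show ?thesis using \<open>m > 0\<close> by simp
  qed
  define Z where "Z = D + replicate_mset (r * n - size D) a"
  define W where "W = R + replicate_mset (h - size R) a"
  have size_Y: "m * size D + size R + c = r * h" using assms(5) Y DR(1) by simp
  \<comment> \<open>Away from \<open>a\<close> the identity is just
    \<open>Y' = repeat_mset m D + R\<close>, so only the multiplicity of \<open>a\<close> has to
    balance. The bounds on \<open>D\<close> and \<open>R\<close> make the truncated differences
    exact.\<close>
  have "c + m * (r * n) = m * (r * n - size D) + (h - size R) + (r - 1) * h"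
  proof -
    have "m * (r * n - size D) + m * size D = m * (r * n)"
      using size_D by (simp flip: distrib_left)
    moreover have "(r - 1) * h + h = r * h" using \<open>r \<ge> 1\<close> by (simp add: algebra_simps)
    ultimately show ?thesis using size_Y size_R by linarith
  qed
  then have "Y + replicate_mset (m * (r * n)) a
    = repeat_mset m Z + W + replicate_mset ((r - 1) * h) a"
    by (simp add: multiset_eq_iff Y DR(1) Z_def W_def)
  moreover have "set_mset Z \<subseteq> F" "set_mset W \<subseteq> F"
    using set_D set_R \<open>a \<in> F\<close> by (auto simp: Z_def W_def)
  moreover have "size Z = r * n" "size W = h"
    using size_D size_R by (auto simp: Z_def W_def)
  ultimately show ?thesis using that by blast
qed

section \<open>Covering by translates\<close>

lemma sumset_mult_cover:
  fixes F :: "'a::ab_group_add set"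
  assumes "finite F" "F \<noteq> {}" "r \<ge> 1"
  obtains X where "finite X" "card X \<le> ((r + 1) * (card F - 1)) choose (card F - 1)"
    "sumset (r * h) F \<subseteq> X + sumset h F"
proof -
  obtain a where "a \<in> F" using assms by blast
  obtain n where n: "card F = Suc n"
    using assms by (metis card_eq_0_iff not0_implies_Suc)
  define m where "m = h div n + 1"
  \<comment> \<open>Solving the identity of \<open>mset_split\<close> for the sum of
    \<open>Y\<close> leaves this translation, which is the same for every \<open>Y\<close>; hence
    the translates depend on \<open>Z\<close> alone.\<close>
  define c where "c = sum_mset (replicate_mset ((r - 1) * h) a)
    - sum_mset (replicate_mset (m * (r * n)) a)"
  define \<Z> where "\<Z> = {Z. set_mset Z \<subseteq> F \<and> size Z = r * n}"
  define X where "X = (\<lambda>Z. sum_mset (repeat_mset m Z) + c) ` \<Z>"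
  have "finite \<Z>" unfolding \<Z>_def by (rule finite_msets_of_size[OF assms(1,2)])
  have "card X \<le> card \<Z>" unfolding X_def using \<open>finite \<Z>\<close> by (rule card_image_le)
  also have "\<dots> \<le> (r * n + n) choose (r * n)"
    using card_msets_of_size_le[OF assms(1,2), of "r * n"] n by (simp add: \<Z>_def)
  also have "\<dots> = ((r + 1) * (card F - 1)) choose (card F - 1)"
    using binomial_symmetric[of n "r * n + n"] n by (simp add: algebra_simps)
  finally have "card X \<le> ((r + 1) * (card F - 1)) choose (card F - 1)" .
  moreover have "finite X" unfolding X_def using \<open>finite \<Z>\<close> by simp
  moreover have "sumset (r * h) F \<subseteq> X + sumset h F"
  proof
    fix y assume "y \<in> sumset (r * h) F"
    then obtain Y where Y: "set_mset Y \<subseteq> F" "size Y = r * h" "y = sum_mset Y"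
      by (auto simp: sumset_eq_sum_mset)
    obtain Z W where ZW: "set_mset Z \<subseteq> F" "size Z = r * n" "set_mset W \<subseteq> F" "size W = h"
      "Y + replicate_mset (m * (r * n)) a
        = repeat_mset m Z + W + replicate_mset ((r - 1) * h) a"
      using mset_split[OF assms(1) \<open>a \<in> F\<close> n Y(1,2) assms(3) m_def] .
    have "y = (sum_mset (repeat_mset m Z) + c) + sum_mset W"
      using arg_cong[OF ZW(5), of sum_mset] Y(3)
      by (simp add: c_def algebra_simps eq_diff_eq)
    moreover have "sum_mset (repeat_mset m Z) + c \<in> X"
      using ZW by (auto simp: X_def \<Z>_def)
    moreover have "sum_mset W \<in> sumset h F"
      using ZW by (auto simp: sumset_eq_sum_mset)
    ultimately show "y \<in> X + sumset h F" by auto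
  qed
  ultimately show ?thesis using that by blast
qed

text \<open>Iterated sumsets distribute over \<open>F + M\<close>, and the part from
  \<open>M\<close> is absorbed without translates, so a cover for \<open>F\<close> serves
  unchanged.\<close>

lemma sumset_mult_cover_submonoid:
  fixes F M :: "'a::ab_group_add set"
  assumes "finite F" "F \<noteq> {}" "is_submonoid M" "r \<ge> 1"
  shows "\<exists>X. finite X \<and> card X \<le> ((r + 1) * (card F - 1)) choose (card F - 1) \<and>
    sumset (r * h) (F + M) \<subseteq> X + sumset h (F + M)"
proof -
  obtain X where X: "finite X" "card X \<le> ((r + 1) * (card F - 1)) choose (card F - 1)"
    "sumset (r * h) F \<subseteq> X + sumset h F"
    using sumset_mult_cover[OF assms(1,2,4)] .
  have "sumset (r * h) (F + M) \<subseteq> (X + sumset h F) + sumset h M"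
    unfolding sumset_set_plus
    using X(3) sumset_mult_submonoid_subset[OF assms(3)] by (rule set_plus_mono2)
  with X show ?thesis by (auto simp: sumset_set_plus add.assoc)
qed

theorem theorem1p14:
  fixes A F M :: "nat \<Rightarrow> 'a::ab_group_add set" and k :: "nat \<Rightarrow> nat" and q r :: nat
  assumes "\<And>i. i \<in> {1..q} \<Longrightarrow> finite (F i)"
    and "\<And>i. i \<in> {1..q} \<Longrightarrow> F i \<noteq> {}"
    and "\<And>i. i \<in> {1..q} \<Longrightarrow> is_submonoid (M i)"
    and "\<And>i. i \<in> {1..q} \<Longrightarrow> A i = F i + M i"
    and "\<And>i. i \<in> {1..q} \<Longrightarrow> k i = card (F i)"
    and "r \<ge> 1"
  shows "(\<forall>h :: nat \<Rightarrow> nat. \<exists>X.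
            chromatic_sumset q (\<lambda>i. r * h i) A \<subseteq> X + chromatic_sumset q h A \<and>
            finite X \<and> card X \<le> (\<Prod>i\<in>{1..q}. ((r + 1) * (k i - 1)) choose (k i - 1)))
       \<and> chromatic_approximate_group r
            (\<Prod>i\<in>{1..q}. ((r + 1) * (k i - 1)) choose (k i - 1)) q A"
proof -
  have "\<exists>X. chromatic_sumset q (\<lambda>i. r * h i) A \<subseteq> X + chromatic_sumset q h A \<and>
      finite X \<and> card X \<le> (\<Prod>i\<in>{1..q}. ((r + 1) * (k i - 1)) choose (k i - 1))"
    for h :: "nat \<Rightarrow> nat"
  proof -
    have "\<forall>i\<in>{1..q}. \<exists>X. finite X \<and> card X \<le> ((r + 1) * (k i - 1)) choose (k i - 1) \<and>
        sumset (r * h i) (A i) \<subseteq> X + sumset (h i) (A i)"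
      using sumset_mult_cover_submonoid[OF assms(1-3) assms(6)] assms(4,5) by simp
    then obtain X where X: "\<And>i. i \<in> {1..q} \<Longrightarrow> finite (X i)"
      "\<And>i. i \<in> {1..q} \<Longrightarrow> card (X i) \<le> ((r + 1) * (k i - 1)) choose (k i - 1)"
      "\<And>i. i \<in> {1..q} \<Longrightarrow> sumset (r * h i) (A i) \<subseteq> X i + sumset (h i) (A i)"
      by metis
    \<comment> \<open>The covers chosen for the single indices are added as sets; regrouping the
      sums preserves the inclusion, and the cardinalities at most multiply.\<close>
    have "chromatic_sumset q (\<lambda>i. r * h i) A \<subseteq> sum X {1..q} + chromatic_sumset q h A"
      unfolding chromatic_sumset_def sum.distrib[symmetric] using X(3) by (rule sum_set_mono)
    moreover have "finite (sum X {1..q})" using X(1) by (rule finite_sum_set)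
    moreover have "card (sum X {1..q}) \<le> (\<Prod>i\<in>{1..q}. card (X i))"
      using X(1) by (rule card_sum_set_le)
    moreover have "(\<Prod>i\<in>{1..q}. card (X i))
        \<le> (\<Prod>i\<in>{1..q}. ((r + 1) * (k i - 1)) choose (k i - 1))"
      using X(2) by (intro prod_mono) auto
    ultimately show ?thesis by (meson order_trans)
  qed
  then show ?thesis unfolding chromatic_approximate_group_def by blast
qed

end
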